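(* Let $n$ be a positive integer and let $r_1,\ldots,r_n$ be positive real numbers. Then the following statements are equivalent: (1) Every homothetic packing of $n$ squares with radii $r_1,\ldots,r_n$ has at most $2n-2$ contacts. (2) The only function $\sigma:[n]\to\{-1,0,1\}$ that takes the value $0$ at least $4$ times and satisfies $\sum_{i=1}^n \sigma_i r_i = 0$ is the zero function.
   Context: Let $S=\{(x,y): -1\le x,y\le 1\}\subset\mathbb{R}^2$ and $[n]=\{1,\ldots,n\}$. A homothetic copy of $S$ is a set $rS+p=\{rx+p: x\in S\}$ with $r>0$, $p\in\mathbb{R}^2$. A homothetic packing of $n$ squares is a set $P=\{S_1,\ldots,S_n\}$ of homothetic copies $S_i=r_iS+p_i$ of $S$ such that for distinct $i,j$ the interiors of $S_i$ and $S_j$ are disjoint; $r_1,\ldots,r_n$ are its radii and $p_1,\ldots,p_n$ its centres. A contact of $P$ is an unordered pair $\{i,j\}$ of distinct indices with $S_i\cap S_j\neq\emptyset$; the number of contacts is the number of such pairs. *)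

theory Defs
  imports "HOL-Analysis.Analysis"
begin

definition std_square :: "(real \<times> real) set" where
  "std_square = {(x, y). -1 \<le> x \<and> x \<le> 1 \<and> -1 \<le> y \<and> y \<le> 1}"

definition hcopy :: "real \<Rightarrow> real \<times> real \<Rightarrow> (real \<times> real) set" where
  "hcopy r p = (\<lambda>x. r *\<^sub>R x + p) ` std_square"

definition homothetic_packing :: "nat \<Rightarrow> (nat \<Rightarrow> real) \<Rightarrow> (nat \<Rightarrow> real \<times> real) \<Rightarrow> bool" where
  "homothetic_packing n r p \<longleftrightarrow>
     (\<forall>i\<in>{1..n}. r i > 0) \<and>
     (\<forall>i\<in>{1..n}. \<forall>j\<in>{1..n}. i \<noteq> j \<longrightarrow>
        interior (hcopy (r i) (p i)) \<inter> interior (hcopy (r j) (p j)) = {})"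

definition contacts :: "nat \<Rightarrow> (nat \<Rightarrow> real) \<Rightarrow> (nat \<Rightarrow> real \<times> real) \<Rightarrow> nat set set" where
  "contacts n r p = {{i, j} | i j. i \<in> {1..n} \<and> j \<in> {1..n} \<and> i \<noteq> j \<and>
       hcopy (r i) (p i) \<inter> hcopy (r j) (p j) \<noteq> {}}"

end

theory Submission
  imports Defs
begin

text \<open>
  Call a contact horizontal or vertical according to the side along which the squares meet, with
  corner contacts distributed by their diagonal direction. If both contact graphs are forests,
  there are at most \<open>2 * (n - 1)\<close> contacts. Going once around a cycle of horizontal contacts, the
  displacements \<open>\<plusminus>(r i + r j)\<close> add up to \<open>0\<close>, and the radius of a square survives (with
  coefficient \<open>\<plusminus>2\<close>) unless the cycle turns around there, so the cycle yields a relation \<open>\<sigma>\<close>;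
  it is nonzero because a cycle cannot zigzag along a single vertical line. If nonzero relations
  have at most three zeros, the cycle turns only at its two ends and misses at most one square.
  The two ends then have next to no vertical contacts, which compensates for the additional
  horizontal ones.

  Conversely, given \<open>\<sigma>\<close> place the squares with \<open>\<sigma> = 1\<close> and those with \<open>\<sigma> = -1\<close> in two rows of
  the same length above and below a line, and one of four squares with \<open>\<sigma> = 0\<close> at each end of
  each row, so that at both ends four squares meet in a point. Adding squares to the shorter row,
  each square gains two contacts, and each of the two crossing points contributes an additional one.
\<close>

section \<open>Cycles and forests\<close>

definition edge_set :: "('a \<Rightarrow> 'a \<Rightarrow> bool) \<Rightarrow> 'a set \<Rightarrow> 'a set set" where
  "edge_set A V = {{i, j} | i j. i \<in> V \<and> j \<in> V \<and> i \<noteq> j \<and> A i j}"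

text \<open>A permutation without fixed points or orbits of length 2, so every orbit has length at
  least 3. \<open>C\<close> may consist of several orbits: summation over \<open>C\<close> only uses
  that \<open>f\<close> permutes it.\<close>

definition is_cycle :: "('a \<Rightarrow> 'a \<Rightarrow> bool) \<Rightarrow> 'a set \<Rightarrow> ('a \<Rightarrow> 'a) \<Rightarrow> bool" where
  "is_cycle A C f \<longleftrightarrow> finite C \<and> C \<noteq> {} \<and> bij_betw f C C \<and> (\<forall>v\<in>C. A v (f v) \<and> f (f v) \<noteq> v)"

lemma finite_edge_set: "finite V \<Longrightarrow> finite (edge_set A V)"
  by (rule finite_subset[of _ "Pow V"]) (auto simp: edge_set_def)

lemma edge_set_mono:
  "V \<subseteq> W \<Longrightarrow> (\<And>i j. i \<in> V \<Longrightarrow> j \<in> V \<Longrightarrow> A i j \<Longrightarrow> B i j) \<Longrightarrow> edge_set A V \<subseteq> edge_set B W"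
  unfolding edge_set_def by blast

lemma card_edge_set_remove:
  assumes "finite V" "symp A"
  shows "card (edge_set A V) \<le> card (edge_set A (V - {v})) + card {u \<in> V - {v}. A v u}"
proof -
  let ?N = "{u \<in> V - {v}. A v u}"
  have "edge_set A V \<subseteq> edge_set A (V - {v}) \<union> (\<lambda>u. {v, u}) ` ?N"
  proof
    fix e assume "e \<in> edge_set A V"
    then obtain i j where e: "e = {i, j}" "i \<in> V" "j \<in> V" "i \<noteq> j" "A i j"
      by (auto simp: edge_set_def)
    have "A j i" using e(5) assms(2) by (auto dest: sympD)
    show "e \<in> edge_set A (V - {v}) \<union> (\<lambda>u. {v, u}) ` ?N"
    proof (cases "v = i \<or> v = j")
      case True
      then show ?thesis using e \<open>A j i\<close> by (auto simp: image_iff doubleton_eq_iff)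
    next
      case False
      then show ?thesis using e by (auto simp: edge_set_def)
    qed
  qed
  then have "card (edge_set A V) \<le> card (edge_set A (V - {v}) \<union> (\<lambda>u. {v, u}) ` ?N)"
    using assms by (intro card_mono) (auto simp: finite_edge_set)
  also have "\<dots> \<le> card (edge_set A (V - {v})) + card ((\<lambda>u. {v, u}) ` ?N)"
    by (rule card_Un_le)
  also have "card ((\<lambda>u. {v, u}) ` ?N) \<le> card ?N"
    using assms by (intro card_image_le) auto
  finally show ?thesis by simp
qed

text \<open>A walk that never turns straight back can go on forever, so it revisits a vertex; a
  shortest segment between equal vertices is a cycle.\<close>

lemma ex_cycle_of_min_degree_2:
  assumes fin: "finite V" and ne: "V \<noteq> {}"
    and deg: "\<And>v. v \<in> V \<Longrightarrow> 2 \<le> card {u \<in> V - {v}. A v u}"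
  obtains C f where "C \<subseteq> V" "is_cycle A C f"
proof -
  have nxt: "\<exists>w\<in>V. w \<noteq> v \<and> w \<noteq> u \<and> A v w" if "v \<in> V" for u v
  proof (rule ccontr)
    assume "\<not> ?thesis"
    then have "{u \<in> V - {v}. A v u} \<subseteq> {u}" by auto
    then have "card {u \<in> V - {v}. A v u} \<le> card {u}" by (intro card_mono) auto
    then show False using deg[OF that] by simp
  qed
  \<comment> \<open>The state of the walk is its current oriented edge, so that the next vertex can
    avoid the one just left.\<close>
  define P where "P = (\<lambda>(k::nat) (q::'a \<times> 'a). fst q \<in> V \<and> snd q \<in> V \<and> A (fst q) (snd q) \<and> fst q \<noteq> snd q)"
  define Q where "Q = (\<lambda>(k::nat) (q::'a \<times> 'a) (q'::'a \<times> 'a). fst q' = snd q \<and> snd q' \<noteq> fst q)"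
  obtain v0 where "v0 \<in> V" using ne by auto
  then obtain v1 where "v1 \<in> V" "v1 \<noteq> v0" "A v0 v1" using nxt by blast
  then have ex0: "\<exists>q. P 0 q" using \<open>v0 \<in> V\<close> unfolding P_def
    by (intro exI[of _ "(v0, v1)"]) simp
  have exS: "\<exists>q'. P (Suc k) q' \<and> Q k q q'" if Pq: "P k q" for q k
  proof -
    obtain w where "w \<in> V" "w \<noteq> snd q" "w \<noteq> fst q" "A (snd q) w"
      using nxt[of "snd q" "fst q"] Pq by (auto simp: P_def)
    then show ?thesis using Pq unfolding P_def Q_def
      by (intro exI[of _ "(snd q, w)"]) simp
  qed
  obtain h where h: "\<And>k. P k (h k)" "\<And>k. Q k (h k) (h (Suc k))"
    using dependent_nat_choice[of P Q, OF ex0 exS] by blast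
  define w where "w = (\<lambda>k. fst (h k))"
  have snd_h: "snd (h k) = w (Suc k)" for k
    using h(2)[of k] by (simp add: w_def Q_def)
  have wV: "w k \<in> V" and wA: "A (w k) (w (Suc k))" and w1: "w (Suc k) \<noteq> w k" for k
    using h(1)[of k] snd_h[of k] by (auto simp: P_def w_def)
  have w2: "w (Suc (Suc k)) \<noteq> w k" for k
    using h(2)[of k] snd_h[of "Suc k"] by (simp add: Q_def w_def)
  \<comment> \<open>\<open>D d\<close> holds if some two visits to a vertex lie \<open>d\<close>
    steps apart. Minimality of \<open>d\<close> makes \<open>w\<close> injective on a window of
    length \<open>d\<close>.\<close>
  define D where "D = (\<lambda>d. d > 0 \<and> (\<exists>i. w i = w (i + d)))"
  have "\<not> inj w"
    using fin wV by (metis finite_subset infinite_UNIV_nat finite_imageD image_subsetI)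
  then obtain a b where "a < b" "w a = w b"
    by (auto simp: inj_def) (metis nat_neq_iff)
  then have "D (b - a)" unfolding D_def by (auto intro: exI[of _ a])
  define d where "d = (LEAST d. D d)"
  have "D d" unfolding d_def by (rule LeastI) fact
  have dmin: "D d' \<Longrightarrow> d \<le> d'" for d' unfolding d_def by (rule Least_le)
  obtain i where i: "w i = w (i + d)" "d > 0" using \<open>D d\<close> by (auto simp: D_def)
  have inj: "inj_on w {i..<i + d}"
  proof (rule linorder_inj_onI)
    fix x y assume "x < y" "x \<in> {i..<i + d}" "y \<in> {i..<i + d}"
    show "w x \<noteq> w y"
    proof
      assume "w x = w y"
      then have "D (y - x)" using \<open>x < y\<close> unfolding D_def by (auto intro: exI[of _ x])
      then have "d \<le> y - x" by (rule dmin)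
      then show False using \<open>x \<in> _\<close> \<open>y \<in> _\<close> \<open>x < y\<close> by auto
    qed
  qed auto
  have "d \<noteq> 1" "d \<noteq> 2" using i w1[of i] w2[of i] by auto
  then have d3: "d \<ge> 3" using i by linarith
  define C where "C = w ` {i..<i + d}"
  define f where "f = (\<lambda>v. w (Suc (the_inv_into {i..<i + d} w v)))"
  have f: "f (w k) = w (Suc k)" if "k \<in> {i..<i + d}" for k
    unfolding f_def using the_inv_into_f_f[OF inj that] by simp
  have "f ` C = (\<lambda>k. w (Suc k)) ` {i..<i + d}"
    unfolding C_def image_image by (rule image_cong) (auto simp: f)
  also have "\<dots> = w ` {Suc i..<Suc (i + d)}"
    by (simp flip: image_Suc_atLeastLessThan add: image_image)
  also have "{Suc i..<Suc (i + d)} = insert (i + d) {Suc i..<i + d}" using i by auto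
  also have "w ` \<dots> = w ` (insert i {Suc i..<i + d})" using i by simp
  also have "insert i {Suc i..<i + d} = {i..<i + d}" using i by auto
  finally have im: "f ` C = C" by (simp add: C_def)
  have finC: "finite C" by (simp add: C_def)
  have bij: "bij_betw f C C"
    using im finC by (simp add: bij_betw_def eq_card_imp_inj_on)
  have "A v (f v) \<and> f (f v) \<noteq> v" if vC: "v \<in> C" for v
  proof -
    obtain k where k: "v = w k" "k \<in> {i..<i + d}" using vC by (auto simp: C_def)
    show ?thesis
    proof (cases "Suc k < i + d")
      case True
      then show ?thesis using k f[of k] f[of "Suc k"] wA w2 by auto
    next
      case False
      then have "Suc k = i + d" using k by auto
      then have "f v = w i" using k f i by auto
      moreover have "f (w i) = w (Suc i)" by (rule f) (use i in auto)
      \<comment> \<open>Here \<open>k\<close> is the last index of the window, and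
        \<open>Suc i\<close> is an earlier one because \<open>d\<close> is at least 3.\<close>
      moreover have "w (Suc i) \<noteq> w k"
        using inj_onD[OF inj, of "Suc i" k] k d3 \<open>Suc k = i + d\<close> by auto
      ultimately show ?thesis using wA[of k] k f[of k] by auto
    qed
  qed
  moreover have "C \<noteq> {}" using i by (auto simp: C_def)
  ultimately have "is_cycle A C f" using finC bij by (auto simp: is_cycle_def)
  moreover have "C \<subseteq> V" using wV by (auto simp: C_def)
  ultimately show ?thesis using that by blast
qed

text \<open>Without a cycle some vertex has degree at most 1; induct by deleting it.\<close>

lemma card_edge_set_forest:
  assumes "finite V" "V \<noteq> {}" "symp A" "\<nexists>C f. C \<subseteq> V \<and> is_cycle A C f"
  shows "card (edge_set A V) + 1 \<le> card V"
  using assms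
proof (induction "card V" arbitrary: V rule: less_induct)
  case less
  have "\<exists>v\<in>V. card {u \<in> V - {v}. A v u} < 2"
  proof (rule ccontr)
    assume "\<not> ?thesis"
    then have "\<And>v. v \<in> V \<Longrightarrow> 2 \<le> card {u \<in> V - {v}. A v u}" by (auto simp: not_less)
    then show False
      using ex_cycle_of_min_degree_2[OF less.prems(1,2), of A] less.prems(4) by blast
  qed
  then obtain v where v: "v \<in> V" "card {u \<in> V - {v}. A v u} < 2" by blast
  show ?case
  proof (cases "V = {v}")
    case True
    then have "edge_set A V = {}" by (auto simp: edge_set_def)
    then show ?thesis using True by simp
  next
    case False
    have "card (V - {v}) < card V" using v less.prems by (intro psubset_card_mono) auto
    then have "card (edge_set A (V - {v})) + 1 \<le> card (V - {v})"
      using less.prems False v by (intro less.hyps) auto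
    then show ?thesis
      using card_edge_set_remove[OF less.prems(1,3), of v] v less.prems(1)
        card_Suc_Diff1[OF less.prems(1) v(1)] by linarith
  qed
qed

section \<open>Horizontal and vertical contact graphs\<close>

text \<open>Square \<open>j\<close> touches \<open>i\<close> from the right. A contact in a corner only counts if \<open>j\<close> lies to the
  north-east of \<open>i\<close>; the south-east corners are vertical contacts, that is, horizontal contacts
  of the packing rotated by a quarter turn, \<open>(X, Y)\<close> being replaced by \<open>(Y, - X)\<close>. With this
  convention every contact is horizontal or vertical, and never both.\<close>

definition east :: "('a \<Rightarrow> real) \<Rightarrow> ('a \<Rightarrow> real) \<Rightarrow> ('a \<Rightarrow> real) \<Rightarrow> 'a \<Rightarrow> 'a \<Rightarrow> bool" where
  "east r X Y i j \<longleftrightarrow> X j - X i = r i + r j \<and> - (r i + r j) < Y j - Y i \<and> Y j - Y i \<le> r i + r j"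

definition adj :: "('a \<Rightarrow> real) \<Rightarrow> ('a \<Rightarrow> real) \<Rightarrow> ('a \<Rightarrow> real) \<Rightarrow> 'a \<Rightarrow> 'a \<Rightarrow> bool" where
  "adj r X Y i j \<longleftrightarrow> east r X Y i j \<or> east r X Y j i"

text \<open>The condition on sign functions in the theorem, for an arbitrary index set.\<close>

definition unbalanced :: "'a set \<Rightarrow> ('a \<Rightarrow> real) \<Rightarrow> bool" where
  "unbalanced V r \<longleftrightarrow> (\<forall>\<sigma> :: 'a \<Rightarrow> int.
     (\<forall>i\<in>V. \<sigma> i \<in> {-1, 0, 1}) \<and> card {i \<in> V. \<sigma> i = 0} \<ge> 4 \<and>
     (\<Sum>i\<in>V. real_of_int (\<sigma> i) * r i) = 0 \<longrightarrow> (\<forall>i\<in>V. \<sigma> i = 0))"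

text \<open>A cycle of horizontal contacts that turns only at its leftmost square \<open>L\<close>, where it continues
  to \<open>T\<close> and \<open>B\<close>, and at its rightmost square \<open>R\<close>, which it reaches from \<open>T'\<close> and \<open>B'\<close>.\<close>

definition two_ended ::
  "('a \<Rightarrow> 'a \<Rightarrow> bool) \<Rightarrow> 'a set \<Rightarrow> 'a \<Rightarrow> 'a \<Rightarrow> 'a \<Rightarrow> 'a \<Rightarrow> 'a \<Rightarrow> 'a \<Rightarrow> bool" where
  "two_ended E C L T B R T' B' \<longleftrightarrow>
     {L, T, B, R, T', B'} \<subseteq> C \<and> T \<noteq> B \<and> T' \<noteq> B' \<and> E L T \<and> E L B \<and> E T' R \<and> E B' R \<and>
     (\<forall>v\<in>C - {L}. \<exists>u\<in>C. E u v \<and> (u = L \<longrightarrow> v \<in> {T, B})) \<and>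
     (\<forall>v\<in>C - {R}. \<exists>w\<in>C. E v w \<and> (w = R \<longrightarrow> v \<in> {T', B'}))"

text \<open>Together with \<open>east_neg\<close> this transfers each fact about the left end to the
  right end, by a half turn of the packing.\<close>

lemma two_ended_converse:
  "two_ended E C L T B R T' B' \<Longrightarrow> two_ended (\<lambda>i j. E j i) C R T' B' L T B"
  unfolding two_ended_def by blast

lemma east_neg: "east r (\<lambda>i. - X i) (\<lambda>i. - Y i) = (\<lambda>i j. east r X Y j i)"
  by (auto simp: east_def fun_eq_iff)

lemma adj_neg: "adj r (\<lambda>i. - X i) (\<lambda>i. - Y i) = adj r X Y"
  by (auto simp: adj_def east_neg fun_eq_iff)

lemma adj_neg': "adj r (\<lambda>i. - Y i) X = adj r Y (\<lambda>i. - X i)"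
  using adj_neg[of r Y "\<lambda>i. - X i"] by simp

lemma symp_adj: "symp (adj r X Y)"
  by (auto simp: symp_def adj_def)

text \<open>A packing in terms of its centres \<open>(X i, Y i)\<close>. Quarter and half turns are
  again instances, which yields the facts about vertical contacts and about right ends.\<close>

locale square_packing =
  fixes V :: "'a set" and r X Y :: "'a \<Rightarrow> real"
  assumes fin: "finite V"
    and pos: "i \<in> V \<Longrightarrow> r i > 0"
    and sep: "i \<in> V \<Longrightarrow> j \<in> V \<Longrightarrow> i \<noteq> j \<Longrightarrow> r i + r j \<le> \<bar>X i - X j\<bar> \<or> r i + r j \<le> \<bar>Y i - Y j\<bar>"
begin

lemma square_packing_rotate: "square_packing V r Y (\<lambda>i. - X i)"
  using fin pos sep by unfold_locales fastforce+

lemma square_packing_neg: "square_packing V r (\<lambda>i. - X i) (\<lambda>i. - Y i)"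
  using fin pos sep by unfold_locales fastforce+

lemma east_less: "i \<in> V \<Longrightarrow> j \<in> V \<Longrightarrow> east r X Y i j \<Longrightarrow> X i < X j"
  using pos[of i] pos[of j] by (auto simp: east_def)

lemma not_adj_self: "i \<in> V \<Longrightarrow> \<not> adj r X Y i i"
  using east_less[of i i] by (auto simp: adj_def)

lemma adj_disjoint:
  assumes "i \<in> V" "j \<in> V" "adj r X Y i j"
  shows "\<not> adj r Y (\<lambda>i. - X i) i j"
  using assms pos[of i] pos[of j] by (auto simp: adj_def east_def)

text \<open>Along a common vertical line \<open>x = c\<close>, of the topmost left square and the topmost right square
  one has only the other as a neighbour.\<close>

lemma interlace:
  assumes "P \<subseteq> V" "Q \<subseteq> V" "P \<noteq> {}"
    and Px: "\<And>p. p \<in> P \<Longrightarrow> X p + r p = c" and Qx: "\<And>q. q \<in> Q \<Longrightarrow> X q - r q = c"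
    and PQ: "\<And>p q. p \<in> P \<Longrightarrow> \<exists>q'\<in>Q. q' \<noteq> q \<and> east r X Y p q'"
    and QP: "\<And>p q. q \<in> Q \<Longrightarrow> \<exists>p'\<in>P. p' \<noteq> p \<and> east r X Y p' q"
  shows False
proof -
  have fP: "finite P" and fQ: "finite Q" using assms fin finite_subset by blast+
  have "Q \<noteq> {}" using PQ \<open>P \<noteq> {}\<close> by blast
  define top where "top = (\<lambda>i. Y i + r i)"
  obtain p where p: "p \<in> P" "\<And>p'. p' \<in> P \<Longrightarrow> top p' \<le> top p"
    using arg_min_if_finite(1)[of P "\<lambda>i. - top i"] arg_min_least[of P _ "\<lambda>i. - top i"]
      fP \<open>P \<noteq> {}\<close> by (metis neg_le_iff_le)
  obtain q where q: "q \<in> Q" "\<And>q'. q' \<in> Q \<Longrightarrow> top q' \<le> top q"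
    using arg_min_if_finite(1)[of Q "\<lambda>i. - top i"] arg_min_least[of Q _ "\<lambda>i. - top i"]
      fQ \<open>Q \<noteq> {}\<close> by (metis neg_le_iff_le)
  obtain q' where q': "q' \<in> Q" "q' \<noteq> q" "east r X Y p q'" using PQ p by blast
  obtain p' where p': "p' \<in> P" "p' \<noteq> p" "east r X Y p' q" using QP q by blast
  have V: "p \<in> V" "p' \<in> V" "q \<in> V" "q' \<in> V" using p q p' q' assms(1,2) by auto
  note rpos = V[THEN pos]
  \<comment> \<open>Squares with right sides on the same vertical line overlap horizontally, so they
    are separated vertically: \<open>p'\<close> lies entirely below \<open>p\<close>, and likewise
    \<open>q'\<close> below \<open>q\<close>.\<close>
  have "top p' \<le> Y p - r p"
    using sep[OF V(2,1) p'(2)] Px[OF p(1)] Px[OF p'(1)] p(2)[OF p'(1)] rpos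
    unfolding top_def by linarith
  moreover have "top q' \<le> Y q - r q"
    using sep[OF V(4,3) q'(2)] Qx[OF q(1)] Qx[OF q'(1)] q(2)[OF q'(1)] rpos
    unfolding top_def by linarith
  \<comment> \<open>The contacts give \<open>Y p - r p < top q'\<close> and
    \<open>Y q - r q \<le> top p'\<close>, closing a circle of inequalities. Its strictness comes
    from the half-open corner convention in \<open>east\<close>.\<close>
  ultimately show False using p'(3) q'(3) unfolding east_def top_def by linarith
qed

text \<open>On \<open>V\<close>, \<open>\<sigma>\<close> vanishes exactly outside \<open>C\<close>
  and at the turns. Left and right turns are equally many, and the leftmost square is a turn; so at
  most three zeros leave one turn of each kind and at most one square outside
  \<open>C\<close>.\<close>

lemma cycle_two_ended:
  assumes unb: "unbalanced V r" and CV: "C \<subseteq> V" and cyc: "is_cycle (adj r X Y) C f"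
  obtains L T B R T' B' where "two_ended (east r X Y) C L T B R T' B'" "card (V - C) \<le> 1"
proof -
  let ?E = "east r X Y"
  have finC: "finite C" "C \<noteq> {}" and bij: "bij_betw f C C"
    and nb: "\<And>v. v \<in> C \<Longrightarrow> ?E v (f v) \<or> ?E (f v) v" and ff: "\<And>v. v \<in> C \<Longrightarrow> f (f v) \<noteq> v"
    using cyc by (auto simp: is_cycle_def adj_def)
  define g where "g = inv_into C f"
  have bijg: "bij_betw g C C" unfolding g_def by (rule bij_betw_inv_into[OF bij])
  have fC: "f v \<in> C" and gC: "g v \<in> C" if "v \<in> C" for v
    using that bij bijg bij_betwE by blast+
  have fg: "f (g v) = v" and gf: "g (f v) = v" if "v \<in> C" for v
    using that bij unfolding g_def
    by (simp_all add: bij_betw_inv_into_right bij_betw_inv_into_left)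
  have fneg: "g v \<noteq> f v" if "v \<in> C" for v using fg[OF that] ff[OF that] by auto
  have less: "?E u v \<Longrightarrow> X u < X v" if "u \<in> C" "v \<in> C" for u v
    using east_less that CV by blast
  \<comment> \<open>Direction of the step from \<open>v\<close> to \<open>f v\<close>:
    \<open>1\<close> eastwards, \<open>-1\<close> westwards.\<close>
  define \<tau> :: "'a \<Rightarrow> int" where "\<tau> = (\<lambda>v. if ?E v (f v) then 1 else -1)"
  have t1: "?E v (f v)" if "\<tau> v = 1" for v using that by (auto simp: \<tau>_def split: if_splits)
  have tm1: "?E (f v) v" if "\<tau> v \<noteq> 1" "v \<in> C" for v using that nb by (auto simp: \<tau>_def split: if_splits)
  have t_cases: "\<tau> v = 1 \<or> \<tau> v = -1" for v by (auto simp: \<tau>_def)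
  have gt1: "?E (g v) v" if "\<tau> (g v) = 1" "v \<in> C" for v using t1[of "g v"] fg that by simp
  have gtm1: "?E v (g v)" if "\<tau> (g v) \<noteq> 1" "v \<in> C" for v using tm1[of "g v"] fg gC that by simp
  have jump: "X (f v) - X v = real_of_int (\<tau> v) * r v + real_of_int (\<tau> v) * r (f v)" if "v \<in> C" for v
    using t1[of v] tm1[of v] t_cases[of v] that by (auto simp: east_def)
  \<comment> \<open>The displacements cancel around the cycle. After reindexing by \<open>f\<close>,
    the radius of \<open>v\<close> has coefficient \<open>\<tau> v + \<tau> (g v)\<close>, from the
    steps out of and into \<open>v\<close>. This is \<open>-2\<close>, \<open>0\<close> or
    \<open>2\<close>, so the halving in \<open>\<sigma>\<close> is exact.\<close>
  have "(\<Sum>v\<in>C. X (f v) - X v) = 0"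
    using sum.reindex_bij_betw[OF bij, of X] by (simp add: sum_subtractf)
  then have "(\<Sum>v\<in>C. real_of_int (\<tau> v) * r v) + (\<Sum>v\<in>C. real_of_int (\<tau> v) * r (f v)) = 0"
    by (simp add: jump sum.distrib cong: sum.cong)
  moreover have "(\<Sum>v\<in>C. real_of_int (\<tau> v) * r (f v)) = (\<Sum>v\<in>C. real_of_int (\<tau> (g v)) * r v)"
    using sum.reindex_bij_betw[OF bij, of "\<lambda>v. real_of_int (\<tau> (g v)) * r v"] by (simp add: gf cong: sum.cong)
  ultimately have bal: "(\<Sum>v\<in>C. real_of_int (\<tau> v + \<tau> (g v)) * r v) = 0"
    by (simp add: distrib_right sum.distrib)
  define \<sigma> :: "'a \<Rightarrow> int" where "\<sigma> = (\<lambda>v. if v \<in> C then (\<tau> v + \<tau> (g v)) div 2 else 0)"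
  have sg2: "2 * \<sigma> v = \<tau> v + \<tau> (g v)" if "v \<in> C" for v
    using that t_cases[of v] t_cases[of "g v"] by (auto simp: \<sigma>_def)
  \<comment> \<open>\<open>S\<close> collects the squares with both cycle neighbours to the east,
    \<open>W\<close> those with both to the west.\<close>
  define S where "S = {v \<in> C. \<tau> v = 1 \<and> \<tau> (g v) = -1}"
  define W where "W = {v \<in> C. \<tau> v = -1 \<and> \<tau> (g v) = 1}"
  have finSW: "finite S" "finite W" "S \<inter> W = {}" "S \<subseteq> C" "W \<subseteq> C"
    using finC by (auto simp: S_def W_def)
  have SW_f: "f v \<in> W \<union> S \<Longrightarrow> v \<in> S \<Longrightarrow> f v \<in> W" "f v \<in> W \<union> S \<Longrightarrow> v \<in> W \<Longrightarrow> f v \<in> S" for v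
    by (auto simp: S_def W_def gf)
  have SW_g: "g v \<in> W \<union> S \<Longrightarrow> v \<in> S \<Longrightarrow> g v \<in> W" "g v \<in> W \<union> S \<Longrightarrow> v \<in> W \<Longrightarrow> g v \<in> S" for v
    by (auto simp: S_def W_def)
  have "(\<Sum>v\<in>C. \<tau> v - \<tau> (g v)) = 0"
    using sum.reindex_bij_betw[OF bijg, of \<tau>] by (simp add: sum_subtractf)
  moreover have "(\<Sum>v\<in>C. \<tau> v - \<tau> (g v)) = (\<Sum>v\<in>C. (if \<tau> v = 1 \<and> \<tau> (g v) = -1 then 2 else 0) -
      (if \<tau> v = -1 \<and> \<tau> (g v) = 1 then 2 else 0))"
    by (intro sum.cong refl) (use t_cases in \<open>auto simp: \<tau>_def\<close>)
  moreover have "\<dots> = 2 * int (card S) - 2 * int (card W)"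
    unfolding S_def W_def sum_subtractf by (simp add: finC sum.inter_filter[symmetric])
  ultimately have cSW: "card S = card W" by simp
  have zeros: "{i \<in> V. \<sigma> i = 0} = (V - C) \<union> (S \<union> W)"
  proof -
    have "\<sigma> v = 0 \<longleftrightarrow> v \<in> S \<union> W" if "v \<in> C" for v
      using that sg2[of v] t_cases[of v] t_cases[of "g v"] by (auto simp: S_def W_def)
    moreover have "\<sigma> v = 0" if "v \<notin> C" for v using that by (simp add: \<sigma>_def)
    ultimately show ?thesis using CV finSW by auto
  qed
  \<comment> \<open>If every square of \<open>C\<close> were a turn, \<open>f\<close> and
    \<open>g\<close> would swap \<open>S\<close> and \<open>W\<close> without ever leaving one
    vertical line, each square having two neighbours across it, against
    \<open>interlace\<close>.\<close>
  have "\<exists>v\<in>V. \<sigma> v \<noteq> 0"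
  proof (rule ccontr)
    assume "\<not> ?thesis"
    then have "C \<subseteq> S \<union> W" using zeros CV by blast
    then have C: "C = W \<union> S" using finSW by auto
    then have swap: "v \<in> S \<Longrightarrow> f v \<in> W" "v \<in> W \<Longrightarrow> f v \<in> S" "v \<in> S \<Longrightarrow> g v \<in> W" "v \<in> W \<Longrightarrow> g v \<in> S" for v
      using SW_f[of v] SW_g[of v] fC[of v] gC[of v] by blast+
    then obtain v0 where "v0 \<in> S" using C finC by blast
    define c where "c = X v0 + r v0"
    show False
    proof (rule interlace[of "{v \<in> S. X v + r v = c}" "{v \<in> W. X v - r v = c}" c])
      fix p q assume p: "p \<in> {v \<in> S. X v + r v = c}"
      then have pC: "p \<in> C" and E: "?E p (f p)" "?E p (g p)"
        using finSW t1[of p] gtm1[of p] by (auto simp: S_def)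
      have "X (f p) - r (f p) = c" "X (g p) - r (g p) = c" using p E by (auto simp: east_def)
      then have "f p \<in> {v \<in> W. X v - r v = c}" "g p \<in> {v \<in> W. X v - r v = c}" using swap p by auto
      then show "\<exists>q'\<in>{v \<in> W. X v - r v = c}. q' \<noteq> q \<and> ?E p q'" using E fneg[OF pC] by metis
    next
      fix p q assume q: "q \<in> {v \<in> W. X v - r v = c}"
      then have qC: "q \<in> C" and E: "?E (f q) q" "?E (g q) q"
        using finSW tm1[of q] gt1[of q] by (auto simp: W_def)
      have "X (f q) + r (f q) = c" "X (g q) + r (g q) = c" using q E by (auto simp: east_def)
      then have "f q \<in> {v \<in> S. X v + r v = c}" "g q \<in> {v \<in> S. X v + r v = c}" using swap q by auto
      then show "\<exists>p'\<in>{v \<in> S. X v + r v = c}. p' \<noteq> p \<and> ?E p' q" using E fneg[OF qC] by metis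
    qed (use CV finSW \<open>v0 \<in> S\<close> c_def in auto)
  qed
  moreover have "\<forall>i\<in>V. \<sigma> i \<in> {-1, 0, 1}"
  proof
    fix i show "\<sigma> i \<in> {-1, 0, 1}"
      using t_cases[of i] t_cases[of "g i"] by (auto simp: \<sigma>_def)
  qed
  moreover have "(\<Sum>i\<in>V. real_of_int (\<sigma> i) * r i) = 0"
  proof -
    have "2 * (\<Sum>i\<in>V. real_of_int (\<sigma> i) * r i) = 2 * (\<Sum>i\<in>C. real_of_int (\<sigma> i) * r i)"
      using CV fin by (intro arg_cong[where f = "(*) 2"] sum.mono_neutral_right) (auto simp: \<sigma>_def)
    also have "\<dots> = (\<Sum>i\<in>C. real_of_int (2 * \<sigma> i) * r i)" by (simp add: sum_distrib_left mult.assoc)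
    also have "\<dots> = 0" using bal by (simp add: sg2 cong: sum.cong)
    finally show ?thesis by simp
  qed
  ultimately have "\<not> 4 \<le> card {i \<in> V. \<sigma> i = 0}" using unb unfolding unbalanced_def by blast
  moreover have "card {i \<in> V. \<sigma> i = 0} = card (V - C) + (card S + card W)"
    unfolding zeros using fin finSW by (subst card_Un_disjoint, force, force, force, subst card_Un_disjoint) auto
  moreover have "S \<noteq> {}"
  proof -
    obtain v where v: "v \<in> C" "\<And>u. u \<in> C \<Longrightarrow> X v \<le> X u"
      using ex_min_if_finite[of "X ` C"] finC by (auto simp: not_less)
    have "\<tau> v = 1" using tm1[OF _ v(1)] less[OF fC[OF v(1)] v(1)] v(2)[OF fC[OF v(1)]] by force
    moreover have "\<tau> (g v) \<noteq> 1" using gt1[OF _ v(1)] less[OF gC[OF v(1)] v(1)] v(2)[OF gC[OF v(1)]] by force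
    ultimately have "v \<in> S" using v t_cases by (auto simp: S_def)
    then show ?thesis by auto
  qed
  then have "card S > 0" using finSW by (simp add: card_gt_0_iff)
  \<comment> \<open>\<open>2 * card S + card (V - C)\<close> is at most 3, and \<open>S\<close> is
    nonempty.\<close>
  ultimately have one: "card S = 1" "card W = 1" "card (V - C) \<le> 1" using cSW by linarith+
  then obtain L R where LR: "S = {L}" "W = {R}" by (auto simp: card_1_singleton_iff)
  then have L: "L \<in> C" "\<tau> L = 1" "\<tau> (g L) = -1" and R: "R \<in> C" "\<tau> R = -1" "\<tau> (g R) = 1"
    by (auto simp: S_def W_def)
  have west: "\<exists>u\<in>C. ?E u v \<and> (u = L \<longrightarrow> v \<in> {f L, g L})" if "v \<in> C - {L}" for v
  proof -
    have v: "v \<in> C" "v \<notin> S" using that LR by auto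
    then have "\<tau> v \<noteq> 1 \<or> \<tau> (g v) = 1" using t_cases by (auto simp: S_def)
    then show ?thesis
    proof
      assume "\<tau> v \<noteq> 1"
      then show ?thesis using tm1 v gf fC by (intro bexI[of _ "f v"]) auto
    next
      assume "\<tau> (g v) = 1"
      then show ?thesis using gt1 v fg gC by (intro bexI[of _ "g v"]) auto
    qed
  qed
  have east': "\<exists>w\<in>C. ?E v w \<and> (w = R \<longrightarrow> v \<in> {f R, g R})" if "v \<in> C - {R}" for v
  proof -
    have v: "v \<in> C" "v \<notin> W" using that LR by auto
    then have "\<tau> v = 1 \<or> \<tau> (g v) \<noteq> 1" using t_cases by (auto simp: W_def)
    then show ?thesis
    proof
      assume "\<tau> v = 1"
      then show ?thesis using t1 v gf fC by (intro bexI[of _ "f v"]) auto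
    next
      assume "\<tau> (g v) \<noteq> 1"
      then show ?thesis using gtm1 v fg gC by (intro bexI[of _ "g v"]) auto
    qed
  qed
  have "two_ended ?E C L (f L) (g L) R (f R) (g R)"
    unfolding two_ended_def
    using L R fC gC fneg[OF L(1)] fneg[OF R(1)] west east' t1[of L] gtm1[of L] tm1[of R] gt1[of R] by auto
  then show ?thesis using that one by blast
qed

section \<open>The left end of a two-ended cycle\<close>

context
  fixes C L T B R T' B'
  assumes CV: "C \<subseteq> V" and te: "two_ended (east r X Y) C L T B R T' B'"
begin

lemma west_neighbour:
  assumes "v \<in> C" "v \<noteq> L"
  obtains u where "u \<in> C" "east r X Y u v" "u = L \<Longrightarrow> v \<in> {T, B}"
proof -
  have "\<forall>v\<in>C - {L}. \<exists>u\<in>C. east r X Y u v \<and> (u = L \<longrightarrow> v \<in> {T, B})"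
    using te by (simp add: two_ended_def)
  then show ?thesis using assms that by blast
qed

text \<open>Otherwise take the leftmost offending square: its west neighbour in \<open>C\<close> is
  not \<open>L\<close> and offends as well, further to the left.\<close>

lemma left_end:
  assumes "u \<in> C" "u \<noteq> L"
  shows "X L + r L \<le> X u - r u"
proof (rule ccontr)
  assume H: "\<not> ?thesis"
  define D where "D = {u \<in> C - {L}. X u - r u < X L + r L}"
  have "finite D" by (rule finite_subset[OF _ fin]) (use CV in \<open>auto simp: D_def\<close>)
  moreover have "D \<noteq> {}" using H assms by (auto simp: D_def)
  ultimately obtain v where v: "v \<in> D" "\<And>u. u \<in> D \<Longrightarrow> X v \<le> X u"
    using ex_min_if_finite[of "X ` D"] by (auto simp: not_less)
  then have vC: "v \<in> C" "v \<noteq> L" "X v - r v < X L + r L" by (auto simp: D_def)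
  obtain w where w: "w \<in> C" "east r X Y w v" using west_neighbour[OF vC(1,2)] by blast
  have "X w + r w = X v - r v" using w by (simp add: east_def)
  moreover have "r w > 0" using pos w CV by auto
  moreover have "w \<noteq> L" using vC calculation by auto
  ultimately have "w \<in> D" using w vC by (auto simp: D_def)
  then show False using v(2)[of w] east_less[of w v] w vC CV by auto
qed

end

context
  fixes C L T B R T' B'
  assumes CV: "C \<subseteq> V" and te: "two_ended (east r X Y) C L T B R T' B'"
begin

lemma two_ended_members: "L \<in> C" "T \<in> C" "B \<in> C" "R \<in> C" "L \<in> V" "T \<in> V" "B \<in> V" "R \<in> V"
  and T_neq_B: "T \<noteq> B" and east_T: "east r X Y L T" and east_B: "east r X Y L B"
  using te CV by (auto simp: two_ended_def)

text \<open>The west neighbour of \<open>u\<close> in \<open>C\<close> ends on the line through the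
  right side of \<open>L\<close>; by \<open>left_end\<close> only \<open>L\<close> itself
  does.\<close>

lemma left_end_tight:
  assumes "u \<in> C" "u \<noteq> L" "X u - r u = X L + r L"
  shows "u \<in> {T, B}"
proof -
  obtain w where w: "w \<in> C" "east r X Y w u" "w = L \<Longrightarrow> u \<in> {T, B}"
    using west_neighbour[OF CV te assms(1,2)] by blast
  have "X w + r w = X L + r L" using w assms by (simp add: east_def)
  moreover have "r w > 0" using pos w CV by auto
  ultimately have "w = L" using left_end[OF CV te, of w] w by force
  then show ?thesis using w by simp
qed

lemma left_end_adj:
  assumes "u \<in> C" "adj r X Y L u"
  shows "u \<in> {T, B}"
proof -
  have V: "u \<in> V" using assms CV by auto
  have ne: "u \<noteq> L" using not_adj_self assms two_ended_members by auto
  have "X u > X L" using left_end[OF CV te assms(1) ne] pos[OF V] pos[of L] two_ended_members by linarith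
  then have "east r X Y L u" using assms(2) east_less[of u L] V two_ended_members by (auto simp: adj_def)
  then show ?thesis using assms ne by (intro left_end_tight) (auto simp: east_def)
qed

text \<open>By \<open>left_end\<close> only a south-east corner contact of \<open>L\<close> remains;
  \<open>left_end_tight\<close> makes that square \<open>T\<close> or \<open>B\<close>, whose
  contacts with \<open>L\<close> are horizontal.\<close>

lemma left_end_not_adj_rotated:
  assumes "u \<in> C"
  shows "\<not> adj r Y (\<lambda>i. - X i) L u"
proof
  assume a: "adj r Y (\<lambda>i. - X i) L u"
  have V: "u \<in> V" using assms CV by auto
  interpret rot: square_packing V r Y "\<lambda>i. - X i" by (rule square_packing_rotate)
  have ne: "u \<noteq> L" using rot.not_adj_self a two_ended_members by auto
  note le = left_end[OF CV te assms ne]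
  have "east r Y (\<lambda>i. - X i) u L" using a le by (auto simp: adj_def east_def)
  then have 1: "X u - r u = X L + r L" "Y L - Y u = r L + r u" using le by (auto simp: east_def)
  then have "east r X Y L u" using left_end_tight[OF assms ne] east_T east_B by auto
  then show False using 1 by (auto simp: east_def)
qed

text \<open>A cycle \<open>C'\<close> avoiding \<open>L\<close> misses only \<open>L\<close>, hence
  contains \<open>T\<close> and \<open>B\<close>. Their west neighbours in \<open>C'\<close> lie
  outside \<open>C\<close>, so both are the same square \<open>w\<close>; then \<open>L\<close>,
  \<open>w\<close> and \<open>T\<close>, \<open>B\<close> contradict
  \<open>interlace\<close>.\<close>

lemma forest_remove_left_end:
  assumes unb: "unbalanced V r" and VC: "card (V - C) \<le> 1"
  shows "\<nexists>C' f. C' \<subseteq> V - {L} \<and> is_cycle (adj r X Y) C' f"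
proof (intro notI, elim exE conjE)
  fix C' f assume C': "C' \<subseteq> V - {L}" "is_cycle (adj r X Y) C' f"
  then have "C' \<subseteq> V" by auto
  obtain L' T1 B1 R1 T2 B2 where te': "two_ended (east r X Y) C' L' T1 B1 R1 T2 B2" and "card (V - C') \<le> 1"
    using cycle_two_ended[OF unb \<open>C' \<subseteq> V\<close> C'(2)] by blast
  have "{L} \<subseteq> V - C'" using C' two_ended_members by auto
  then have "V - C' = {L}" using \<open>card (V - C') \<le> 1\<close> fin card_seteq[of "V - C'" "{L}"] by auto
  then have TB: "T \<in> C'" "B \<in> C'"
    using two_ended_members not_adj_self[of L] east_T east_B by (auto simp: adj_def)
  define c where "c = X L + r L"
  have xTB: "X v - r v = c" if "v \<in> {T, B}" for v
    using that east_T east_B by (auto simp: east_def c_def)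
  have pred: "\<exists>w\<in>V - C. w \<in> C' \<and> east r X Y w v" if v: "v \<in> {T, B}" "v \<noteq> L'" for v
  proof -
    obtain w where w: "w \<in> C'" "east r X Y w v"
      using v TB te' unfolding two_ended_def by blast
    have "X w + r w = c" using w xTB[OF v(1)] by (auto simp: east_def)
    moreover have "w \<noteq> L" "r w > 0" using w C' pos by auto
    ultimately have "w \<notin> C" using left_end[OF CV te, of w] by (force simp: c_def)
    then show ?thesis using w \<open>C' \<subseteq> V\<close> by auto
  qed
  \<comment> \<open>If one of \<open>T\<close>, \<open>B\<close> were the left end of
    \<open>C'\<close>, the west neighbour of the other, ending on the line where both begin, would
    violate \<open>left_end\<close> for \<open>C'\<close>.\<close>
  have not_L': "v \<noteq> L'" if v: "v \<in> {T, B}" "u \<in> {T, B}" "u \<noteq> L'" for u v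
  proof
    assume "v = L'"
    obtain w where w: "w \<in> C'" "east r X Y w u" using pred v by blast
    have "X w + r w = c" using w xTB[OF v(2)] by (auto simp: east_def)
    moreover have wv: "w \<noteq> v"
      using calculation xTB[OF v(1)] pos[of w] w \<open>C' \<subseteq> V\<close> by force
    moreover have "X L' + r L' \<le> X w - r w"
      using wv \<open>v = L'\<close> w left_end[OF \<open>C' \<subseteq> V\<close> te'] by auto
    ultimately show False
      using xTB[OF v(1)] \<open>v = L'\<close> pos[of w] pos[of v] w v \<open>C' \<subseteq> V\<close> two_ended_members by auto
  qed
  have "T \<noteq> L' \<or> B \<noteq> L'" using T_neq_B by auto
  then have "T \<noteq> L'" "B \<noteq> L'" using not_L' by blast+
  then obtain w w' where w: "w \<in> V - C" "east r X Y w T" "w' \<in> V - C" "east r X Y w' B"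
    using pred by blast
  then have "w' = w" using VC fin by (metis card_le_Suc0_iff_eq finite_Diff One_nat_def)
  have "w \<noteq> L" using w two_ended_members by auto
  show False
  proof (rule interlace[of "{L, w}" "{T, B}" c])
    show "X p + r p = c" if "p \<in> {L, w}" for p
      using that w xTB[of T] by (auto simp: c_def east_def)
  qed (use two_ended_members w \<open>w' = w\<close> \<open>w \<noteq> L\<close> T_neq_B east_T east_B xTB in auto)
qed

text \<open>Deleting \<open>L\<close> leaves a forest, with at most \<open>card V - 2\<close>
  contacts; \<open>L\<close> adds those with \<open>T\<close> and \<open>B\<close> and those with
  squares outside \<open>C\<close>.\<close>

lemma card_adj_left_end_le:
  assumes "unbalanced V r" "card (V - C) \<le> 1"
  shows "card (edge_set (adj r X Y) V) \<le> card V + card {u \<in> V - C. adj r X Y L u}"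
proof -
  have "V - {L} \<noteq> {}" using two_ended_members T_neq_B by auto
  then have "card (edge_set (adj r X Y) (V - {L})) + 1 \<le> card (V - {L})"
    by (intro card_edge_set_forest symp_adj forest_remove_left_end assms) (use fin in auto)
  moreover have "card (V - {L}) + 1 = card V"
    using card_Suc_Diff1[OF fin, of L] two_ended_members by simp
  moreover have "card {u \<in> V - {L}. adj r X Y L u} \<le> card ({T, B} \<union> {u \<in> V - C. adj r X Y L u})"
    using fin left_end_adj by (intro card_mono) auto
  moreover have "\<dots> \<le> card {T, B} + card {u \<in> V - C. adj r X Y L u}" by (rule card_Un_le)
  moreover have "card {T, B} = 2" using T_neq_B by simp
  ultimately show ?thesis
    using card_edge_set_remove[OF fin symp_adj, of r X Y L] by linarith
qed

end

text \<open>Let \<open>a\<close>, \<open>b\<close> count the horizontal and vertical contacts of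
  \<open>L\<close> with squares outside \<open>C\<close>, and \<open>a'\<close>, \<open>c\<close>
  those of \<open>R\<close>. There are at most \<open>card V + min a a'\<close> horizontal and
  \<open>card V + b + c - 3\<close> vertical contacts. As \<open>a + b\<close> and
  \<open>a' + c\<close> are at most 1, this suffices unless \<open>b = c = 1\<close>.\<close>

lemma card_adj_le_of_cycle:
  assumes unb: "unbalanced V r" and CV: "C \<subseteq> V" and cyc: "is_cycle (adj r X Y) C f"
  shows "card (edge_set (adj r X Y) V) + card (edge_set (adj r Y (\<lambda>i. - X i)) V) \<le> 2 * card V - 2"
proof -
  let ?A = "adj r X Y" and ?A' = "adj r Y (\<lambda>i. - X i)"
  interpret rot: square_packing V r Y "\<lambda>i. - X i" by (rule square_packing_rotate)
  interpret neg: square_packing V r "\<lambda>i. - X i" "\<lambda>i. - Y i" by (rule square_packing_neg)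
  obtain L T B R T' B' where te: "two_ended (east r X Y) C L T B R T' B'" and VC: "card (V - C) \<le> 1"
    using cycle_two_ended[OF unb CV cyc] by blast
  have te': "two_ended (east r (\<lambda>i. - X i) (\<lambda>i. - Y i)) C R T' B' L T B"
    using two_ended_converse[OF te] by (simp add: east_neg)
  note mem = two_ended_members[OF CV te] T_neq_B[OF CV te] and mem' = neg.two_ended_members[OF CV te']
  have VC_unique: "u = v" if "u \<in> V - C" "v \<in> V - C" for u v
    using that VC fin by (metis card_le_Suc0_iff_eq finite_Diff One_nat_def)
  have noL: "\<not> ?A' L u" and noR: "\<not> ?A' R u" if "u \<in> C" for u
    using left_end_not_adj_rotated[OF CV te that] neg.left_end_not_adj_rotated[OF CV te' that]
    by (simp_all add: adj_neg')
  have right: "X u + r u \<le> X R - r R" if "u \<in> C" "u \<noteq> R" for u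
    using neg.left_end[OF CV te' that] by simp
  have T'R: "east r X Y T' R" using te by (simp add: two_ended_def)
  have TL: "T \<noteq> L" "B \<noteq> L"
    using east_T[OF CV te] east_B[OF CV te] east_less[of L L] mem by auto
  have LR: "L \<noteq> R"
  proof
    assume "L = R"
    moreover have "X T' < X R" using T'R mem mem' by (intro east_less) auto
    ultimately show False
      using left_end[OF CV te, of T'] mem mem' pos[of T'] pos[of L] by force
  qed
  \<comment> \<open>A vertical cycle misses at most one square, yet it would miss both
    \<open>L\<close> and \<open>R\<close>: their vertical neighbours lie outside \<open>C\<close>,
    where there is at most one square, and a cycle needs two.\<close>
  have forest': "\<nexists>C' f'. C' \<subseteq> V \<and> is_cycle ?A' C' f'"
  proof (intro notI, elim exE conjE)
    fix C' f' assume C': "C' \<subseteq> V" "is_cycle ?A' C' f'"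
    have VC': "card (V - C') \<le> 1"
      using rot.cycle_two_ended[OF unb C'] by blast
    have avoid: "Z \<notin> C'" if no: "\<And>u. u \<in> C \<Longrightarrow> \<not> ?A' Z u" for Z
    proof
      assume Z: "Z \<in> C'"
      have bij: "bij_betw f' C' C'" using C' by (simp add: is_cycle_def)
      then obtain u where u: "u \<in> C'" "f' u = Z" using Z by (metis bij_betw_imp_surj_on imageE)
      have "?A' Z (f' Z)" "?A' Z u" "f' (f' Z) \<noteq> Z"
        using C' Z u symp_adj[of r Y "\<lambda>i. - X i"] by (auto simp: is_cycle_def symp_def)
      moreover have "f' Z \<in> V" "u \<in> V" using bij Z u C' bij_betwE by blast+
      ultimately show False using VC_unique[of u "f' Z"] no u by blast
    qed
    then have "{L, R} \<subseteq> V - C'" using noL noR mem by blast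
    then have "card {L, R} \<le> card (V - C')" using fin by (intro card_mono) auto
    then show False using VC' LR by simp
  qed
  define a a' b c where "a = card {u \<in> V - C. ?A L u}" and "a' = card {u \<in> V - C. ?A R u}"
    and "b = card {u \<in> V - C. ?A' L u}" and "c = card {u \<in> V - C. ?A' R u}"
  have disj: "card {u \<in> V - C. ?A Z u} + card {u \<in> V - C. ?A' Z u} \<le> 1" if "Z \<in> V" for Z
  proof -
    have "card {u \<in> V - C. ?A Z u} + card {u \<in> V - C. ?A' Z u}
        = card ({u \<in> V - C. ?A Z u} \<union> {u \<in> V - C. ?A' Z u})"
      using fin adj_disjoint[OF that] by (intro card_Un_disjoint[symmetric]) auto
    also have "\<dots> \<le> card (V - C)" using fin by (intro card_mono) auto
    finally show ?thesis using VC by simp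
  qed
  have ab: "a + b \<le> 1" and a'c: "a' + c \<le> 1"
    unfolding a_def a'_def b_def c_def using disj mem by auto
  have Ex: "card (edge_set ?A V) \<le> card V + a" and Ex': "card (edge_set ?A V) \<le> card V + a'"
    using card_adj_left_end_le[OF CV te unb VC] neg.card_adj_left_end_le[OF CV te' unb VC]
    by (simp_all add: a_def a'_def adj_neg)
  \<comment> \<open>Without \<open>L\<close> and \<open>R\<close> the vertical forest has
    \<open>card V - 2\<close> squares, hence at most \<open>card V - 3\<close> contacts.\<close>
  have Ey: "card (edge_set ?A' V) + 3 \<le> card V + b + c"
  proof -
    have "card (edge_set ?A' V) \<le> card (edge_set ?A' (V - {L})) + card {u \<in> V - {L}. ?A' L u}"
      by (rule card_edge_set_remove[OF fin symp_adj])
    moreover have "card {u \<in> V - {L}. ?A' L u} \<le> b"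
      unfolding b_def using fin noL by (intro card_mono) auto
    moreover have "card (edge_set ?A' (V - {L}))
        \<le> card (edge_set ?A' (V - {L} - {R})) + card {u \<in> V - {L} - {R}. ?A' R u}"
      using fin by (intro card_edge_set_remove symp_adj) auto
    moreover have "card {u \<in> V - {L} - {R}. ?A' R u} \<le> c"
      unfolding c_def using fin noR by (intro card_mono) auto
    moreover have "card (edge_set ?A' (V - {L} - {R})) + 1 \<le> card (V - {L} - {R})"
    proof (intro card_edge_set_forest symp_adj)
      show "V - {L} - {R} \<noteq> {}" using mem TL by auto
    qed (use fin forest' in auto)
    moreover have "card (V - {L} - {R}) + 2 = card V"
      using card_Suc_Diff1[OF fin, of L] card_Suc_Diff1[of "V - {L}" R] fin mem LR by simp
    ultimately show ?thesis by linarith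
  qed
  show ?thesis
  proof (cases "b = 0 \<or> c = 0")
    case True
    then show ?thesis using Ex Ex' Ey ab a'c by auto
  next
    case False
    then have "{u \<in> V - C. ?A' L u} \<noteq> {}" "{u \<in> V - C. ?A' R u} \<noteq> {}"
      unfolding b_def c_def by (metis card.empty)+
    then obtain v where v: "v \<in> V - C" "?A' L v" "?A' R v" using VC_unique by blast
    have vL: "X v - r v \<le> X L + r L" and vR: "X R - r R \<le> X v + r v"
      using v(2,3) by (auto simp: adj_def east_def)
    \<comment> \<open>Touching both \<open>L\<close> and \<open>R\<close> vertically,
      \<open>v\<close> spans the whole gap between them, which contains the horizontal extent of all
      other squares of \<open>C\<close>. So \<open>v\<close> has no horizontal contact, which lowers
      the horizontal count to \<open>card V - 1\<close>.\<close>
    have iso: "\<not> ?A v w" if w: "w \<in> V" for w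
    proof
      assume vw: "?A v w"
      then have "w \<noteq> v" using not_adj_self v by auto
      then have wC: "w \<in> C" using VC_unique[of v w] v w by auto
      have wLR: "w \<noteq> L" "w \<noteq> R"
        using vw v adj_disjoint[of _ v] symp_adj[of r X Y] mem by (auto simp: symp_def)
      have "X w - r w < X w + r w" using pos[OF w] by simp
      then show False
        using vw left_end[OF CV te wC wLR(1)] right[OF wC wLR(2)] vL vR
        by (auto simp: adj_def east_def)
    qed
    have vLne: "v \<noteq> L" using v mem by auto
    have "card (edge_set ?A V) \<le> card (edge_set ?A (V - {v})) + card {u \<in> V - {v}. ?A v u}"
      by (rule card_edge_set_remove[OF fin symp_adj])
    moreover have "card {u \<in> V - {v}. ?A v u} = 0"
      unfolding card_eq_0_iff using iso by blast
    moreover have "card (edge_set ?A (V - {v}))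
        \<le> card (edge_set ?A (V - {v} - {L})) + card {u \<in> V - {v} - {L}. ?A L u}"
      using fin by (intro card_edge_set_remove symp_adj) auto
    moreover have "card {u \<in> V - {v} - {L}. ?A L u} \<le> card {T, B}"
      using left_end_adj[OF CV te] VC_unique[OF v(1)] by (intro card_mono) auto
    moreover have "card {T, B} = 2" using mem by simp
    moreover have "card (edge_set ?A (V - {v} - {L})) + 1 \<le> card (V - {v} - {L})"
    proof (intro card_edge_set_forest symp_adj)
      show "V - {v} - {L} \<noteq> {}" using mem TL v by auto
      show "\<nexists>C f. C \<subseteq> V - {v} - {L} \<and> is_cycle ?A C f"
        using forest_remove_left_end[OF CV te unb VC] by blast
    qed (use fin in auto)
    moreover have "card (V - {v} - {L}) + 2 = card V"
      using card_Suc_Diff1[OF fin, of v] card_Suc_Diff1[of "V - {v}" L] fin mem v vLne by simp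
    ultimately have "card (edge_set ?A V) + 1 \<le> card V" by linarith
    then show ?thesis using Ey ab a'c by linarith
  qed
qed

lemma card_adj_le:
  assumes "unbalanced V r" "V \<noteq> {}"
  shows "card (edge_set (adj r X Y) V) + card (edge_set (adj r Y (\<lambda>i. - X i)) V) \<le> 2 * card V - 2"
proof -
  interpret rot: square_packing V r Y "\<lambda>i. - X i" by (rule square_packing_rotate)
  consider C f where "C \<subseteq> V" "is_cycle (adj r X Y) C f"
    | C f where "C \<subseteq> V" "is_cycle (adj r Y (\<lambda>i. - X i)) C f"
    | "\<nexists>C f. C \<subseteq> V \<and> is_cycle (adj r X Y) C f"
      "\<nexists>C f. C \<subseteq> V \<and> is_cycle (adj r Y (\<lambda>i. - X i)) C f"
    by blast
  then show ?thesis
  proof cases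
    case 1
    then show ?thesis by (rule card_adj_le_of_cycle[OF assms(1)])
  next
    case 2
    then show ?thesis using rot.card_adj_le_of_cycle[OF assms(1) 2] by (simp add: adj_neg)
  next
    case 3
    show ?thesis
      using card_edge_set_forest[OF fin assms(2) symp_adj 3(1)]
        card_edge_set_forest[OF fin assms(2) symp_adj 3(2)] by linarith
  qed
qed

end

section \<open>Packings in two rows\<close>

text \<open>Two rows of squares standing on, respectively hanging from, the line \<open>y = 0\<close>; square \<open>i\<close> has
  horizontal position \<open>x i\<close> in row \<open>s i\<close>, and row \<open>t\<close> extends to the right up to \<open>e t\<close>. As all
  squares meet the line, two of them touch iff their horizontal projections do. The last square
  of either row begins before the end of the other row, so a square appended to the shorter row
  touches the last squares of both.\<close>

definition rows :: "('a \<Rightarrow> real) \<Rightarrow> 'a set \<Rightarrow> nat \<Rightarrow> (bool \<Rightarrow> real) \<Rightarrow> bool" where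
  "rows r I K e \<longleftrightarrow> finite I \<and> (\<forall>i\<in>I. r i > 0) \<and> (\<exists>x s.
     (\<forall>i\<in>I. \<forall>j\<in>I. i \<noteq> j \<and> s i = s j \<longrightarrow> r i + r j \<le> \<bar>x i - x j\<bar>) \<and>
     (\<forall>i\<in>I. x i + r i \<le> e (s i)) \<and>
     (\<forall>t. \<exists>l\<in>I. s l = t \<and> x l + r l = e t \<and> x l - r l \<le> e (\<not> t)) \<and>
     K \<le> card (edge_set (\<lambda>i j. \<bar>x i - x j\<bar> \<le> r i + r j) I))"

lemma card_edge_set_extend:
  assumes "finite I" "finite J" "F \<subseteq> edge_set B J" "I \<subseteq> J" "\<And>e. e \<in> F \<Longrightarrow> \<not> e \<subseteq> I"
    "\<And>i j. i \<in> I \<Longrightarrow> j \<in> I \<Longrightarrow> A i j \<Longrightarrow> B i j"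
  shows "card (edge_set A I) + card F \<le> card (edge_set B J)"
proof -
  have "edge_set A I \<inter> F = {}" using assms(5) by (auto simp: edge_set_def)
  then have "card (edge_set A I) + card F = card (edge_set A I \<union> F)"
    using assms finite_subset[OF assms(3) finite_edge_set]
    by (simp add: card_Un_disjoint finite_edge_set)
  also have "\<dots> \<le> card (edge_set B J)"
    using assms edge_set_mono[of I J A B]
    by (intro card_mono finite_edge_set) auto
  finally show ?thesis .
qed

lemma rows_init:
  assumes "i \<noteq> j" "r i > 0" "r j > 0"
  shows "rows r {i, j} 1 (\<lambda>_. 0)"
proof -
  \<comment> \<open>Both squares end at position \<open>0\<close>, so that
    \<open>rows_add_pair\<close> can produce the first crossing point there.\<close>
  define x where "x = (\<lambda>k. - r k)"
  define s where "s = (\<lambda>k. k = i)"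
  have "{{i, j}} \<subseteq> edge_set (\<lambda>i j. \<bar>x i - x j\<bar> \<le> r i + r j) {i, j}"
    using assms unfolding edge_set_def x_def
    by (intro subsetI CollectI exI[of _ i] exI[of _ j]) auto
  then have "card {{i, j}} \<le> card (edge_set (\<lambda>i j. \<bar>x i - x j\<bar> \<le> r i + r j) {i, j})"
    by (intro card_mono finite_edge_set) auto
  moreover have "\<forall>t. \<exists>l\<in>{i, j}. s l = t \<and> x l + r l = 0 \<and> x l - r l \<le> 0"
    using assms by (auto simp: x_def s_def)
  ultimately show ?thesis
    unfolding rows_def using assms
    by (intro conjI exI[of _ x] exI[of _ s]) (auto simp: x_def s_def)
qed

lemma rows_add:
  assumes "rows r I K e" "i \<notin> I" "r i > 0" "e t \<le> e (\<not> t)"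
  shows "rows r (insert i I) (K + 2) (e(t := e t + 2 * r i))"
proof -
  obtain x s where fin: "finite I" and pos: "\<forall>i\<in>I. r i > 0"
    and sep: "\<forall>i\<in>I. \<forall>j\<in>I. i \<noteq> j \<and> s i = s j \<longrightarrow> r i + r j \<le> \<bar>x i - x j\<bar>"
    and ends: "\<forall>i\<in>I. x i + r i \<le> e (s i)"
    and last: "\<forall>t. \<exists>l\<in>I. s l = t \<and> x l + r l = e t \<and> x l - r l \<le> e (\<not> t)"
    and K: "K \<le> card (edge_set (\<lambda>i j. \<bar>x i - x j\<bar> \<le> r i + r j) I)"
    using assms(1) unfolding rows_def by (elim conjE exE) (rule that; assumption)
  obtain l where l: "l \<in> I" "s l = t" "x l + r l = e t" "x l - r l \<le> e (\<not> t)"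
    using last by blast
  obtain m where m: "m \<in> I" "s m = (\<not> t)" "x m + r m = e (\<not> t)" "x m - r m \<le> e t"
    using last[rule_format, of "\<not> t"] by auto
  define x' where "x' = x(i := e t + r i)"
  define s' where "s' = s(i := t)"
  have x': "x' k = x k" "s' k = s k" if "k \<in> I" for k
    using that assms(2) by (auto simp: x'_def s'_def)
  have xi: "x' i = e t + r i" "s' i = t" by (auto simp: x'_def s'_def)
  have "l \<noteq> m" using l m by auto
  have posl: "r l > 0" "r m > 0" using pos l m by auto
  have il: "\<bar>x' i - x' l\<bar> \<le> r i + r l" and im: "\<bar>x' i - x' m\<bar> \<le> r i + r m"
    using x'[of l] x'[of m] xi l m posl assms(3,4) by linarith+
  have "card (edge_set (\<lambda>i j. \<bar>x i - x j\<bar> \<le> r i + r j) I) + card {{i, l}, {i, m}}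
      \<le> card (edge_set (\<lambda>i j. \<bar>x' i - x' j\<bar> \<le> r i + r j) (insert i I))"
  proof (rule card_edge_set_extend)
    show "{{i, l}, {i, m}} \<subseteq> edge_set (\<lambda>i j. \<bar>x' i - x' j\<bar> \<le> r i + r j) (insert i I)"
      using il im l m assms(2) unfolding edge_set_def by blast
  qed (use fin assms(2) x' in auto)
  moreover have "card {{i, l}, {i, m}} = 2"
    using \<open>l \<noteq> m\<close> by (auto simp: doubleton_eq_iff)
  ultimately have K': "K + 2 \<le> card (edge_set (\<lambda>i j. \<bar>x' i - x' j\<bar> \<le> r i + r j) (insert i I))"
    using K by linarith
  have sepi: "r i + r j \<le> x' i - x' j" if "j \<in> I" "s j = t" for j
    using ends that x'[of j] xi by fastforce
  have sep': "\<forall>a\<in>insert i I. \<forall>b\<in>insert i I. a \<noteq> b \<and> s' a = s' b \<longrightarrow> r a + r b \<le> \<bar>x' a - x' b\<bar>"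
  proof (intro ballI impI)
    fix a b assume ab: "a \<in> insert i I" "b \<in> insert i I" "a \<noteq> b \<and> s' a = s' b"
    consider "a \<in> I" "b \<in> I" | "a = i" "b \<in> I" | "b = i" "a \<in> I" using ab by auto
    then show "r a + r b \<le> \<bar>x' a - x' b\<bar>"
    proof cases
      case 1 then show ?thesis using sep ab x' by auto
    next
      case 2 then show ?thesis using sepi[of b] ab x' xi by auto
    next
      case 3 then show ?thesis using sepi[of a] ab x' xi by auto
    qed
  qed
  let ?e = "e(t := e t + 2 * r i)"
  have ends': "\<forall>a\<in>insert i I. x' a + r a \<le> ?e (s' a)"
  proof
    fix a assume "a \<in> insert i I"
    then consider "a = i" | "a \<in> I" by auto
    then show "x' a + r a \<le> ?e (s' a)"
    proof cases
      case 1 then show ?thesis using xi by simp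
    next
      case 2 then show ?thesis using ends x'[of a] assms(3) by fastforce
    qed
  qed
  \<comment> \<open>\<open>i\<close> begins at the old \<open>e t\<close>, not beyond the end of the
    other row; \<open>m\<close> still ends that row and begins no later than the old
    \<open>e t\<close>.\<close>
  have last': "\<forall>u. \<exists>l\<in>insert i I. s' l = u \<and> x' l + r l = ?e u \<and> x' l - r l \<le> ?e (\<not> u)"
  proof
    fix u
    show "\<exists>l\<in>insert i I. s' l = u \<and> x' l + r l = ?e u \<and> x' l - r l \<le> ?e (\<not> u)"
    proof (cases "u = t")
      case True then show ?thesis using xi assms(4) by (intro bexI[of _ i]) auto
    next
      case False
      then have "u = (\<not> t)" by auto
      then show ?thesis using m x'[of m] assms(3) by (intro bexI[of _ m]) auto
    qed
  qed
  show ?thesis unfolding rows_def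
    using fin pos assms(3) sep' ends' last' K'
    by (intro conjI exI[of _ x'] exI[of _ s']) auto
qed

text \<open>Where both rows end together, the two last and the two new squares meet in a point. Five
  of their six pairs contain a new square, one more than two uses of \<open>rows_add\<close>
  provide.\<close>

lemma rows_add_pair:
  assumes "rows r I K e" "i \<notin> I" "j \<notin> I" "i \<noteq> j" "r i > 0" "r j > 0" "e True = e False"
  shows "rows r (insert i (insert j I)) (K + 5) (\<lambda>u. if u then e True + 2 * r i else e False + 2 * r j)"
proof -
  define c where "c = e True"
  have ec: "e u = c" for u using assms(7) by (cases u) (auto simp: c_def)
  obtain x s where fin: "finite I" and pos: "\<forall>i\<in>I. r i > 0"
    and sep: "\<forall>i\<in>I. \<forall>j\<in>I. i \<noteq> j \<and> s i = s j \<longrightarrow> r i + r j \<le> \<bar>x i - x j\<bar>"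
    and ends0: "\<forall>i\<in>I. x i + r i \<le> e (s i)"
    and last0: "\<forall>t. \<exists>l\<in>I. s l = t \<and> x l + r l = e t \<and> x l - r l \<le> e (\<not> t)"
    and K: "K \<le> card (edge_set (\<lambda>i j. \<bar>x i - x j\<bar> \<le> r i + r j) I)"
    using assms(1) unfolding rows_def by (elim conjE exE) (rule that; assumption)
  note ends = ends0[unfolded ec] and last = last0[unfolded ec]
  obtain l where l: "l \<in> I" "s l = True" "x l + r l = c"
    using last by blast
  obtain m where m: "m \<in> I" "s m = False" "x m + r m = c"
    using last[rule_format, of "False"] by auto
  define x' where "x' = x(i := c + r i, j := c + r j)"
  define s' where "s' = s(i := True, j := False)"
  have x': "x' k = x k" "s' k = s k" if "k \<in> I" for k
    using that assms(2,3) by (auto simp: x'_def s'_def)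
  have xi: "x' i = c + r i" "s' i = True" and xj: "x' j = c + r j" "s' j = False"
    using assms(4) by (auto simp: x'_def s'_def)
  have "l \<noteq> m" using l m by auto
  have posl: "r l > 0" "r m > 0" using pos l m by auto
  have touch: "\<bar>x' i - x' l\<bar> \<le> r i + r l" "\<bar>x' i - x' m\<bar> \<le> r i + r m" "\<bar>x' j - x' l\<bar> \<le> r j + r l"
    "\<bar>x' j - x' m\<bar> \<le> r j + r m" "\<bar>x' i - x' j\<bar> \<le> r i + r j"
    using x'[of l] x'[of m] xi xj l m posl assms(5,6) by linarith+
  let ?F = "{{i, l}, {i, m}, {j, l}, {j, m}, {i, j}}"
  have neq: "i \<noteq> l" "i \<noteq> m" "j \<noteq> l" "j \<noteq> m" using l m assms by auto
  have "card (edge_set (\<lambda>i j. \<bar>x i - x j\<bar> \<le> r i + r j) I) + card ?F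
      \<le> card (edge_set (\<lambda>i j. \<bar>x' i - x' j\<bar> \<le> r i + r j) (insert i (insert j I)))"
  proof (rule card_edge_set_extend)
    show "?F \<subseteq> edge_set (\<lambda>i j. \<bar>x' i - x' j\<bar> \<le> r i + r j) (insert i (insert j I))"
      using touch l m assms(4) neq unfolding edge_set_def by blast
  qed (use fin assms(2,3) x' in auto)
  moreover have "card ?F = 5"
    using \<open>l \<noteq> m\<close> neq assms(4) by (auto simp: doubleton_eq_iff card_insert_if)
  ultimately have K': "K + 5 \<le> card (edge_set (\<lambda>i j. \<bar>x' i - x' j\<bar> \<le> r i + r j) (insert i (insert j I)))"
    using K by linarith
  have sepn: "r k + r a \<le> x' k - x' a" if "a \<in> I" "k = i \<or> k = j" for a k
    using ends that x'[of a] xi xj by fastforce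
  have sep': "\<forall>a\<in>insert i (insert j I). \<forall>b\<in>insert i (insert j I).
      a \<noteq> b \<and> s' a = s' b \<longrightarrow> r a + r b \<le> \<bar>x' a - x' b\<bar>"
  proof (intro ballI impI)
    fix a b assume ab: "a \<in> insert i (insert j I)" "b \<in> insert i (insert j I)" "a \<noteq> b \<and> s' a = s' b"
    consider "a \<in> I" "b \<in> I" | "a = i \<or> a = j" "b \<in> I" | "b = i \<or> b = j" "a \<in> I"
      using ab xi xj by blast
    then show "r a + r b \<le> \<bar>x' a - x' b\<bar>"
    proof cases
      case 1 then show ?thesis using sep ab x' by auto
    next
      case 2 then show ?thesis using sepn[of b a] by linarith
    next
      case 3 then show ?thesis using sepn[of a b] by linarith
    qed
  qed
  let ?e = "\<lambda>u. if u then e True + 2 * r i else e False + 2 * r j"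
  have ends': "\<forall>a\<in>insert i (insert j I). x' a + r a \<le> ?e (s' a)"
    using xi xj x' ends assms(5,6) by (fastforce simp: ec)
  have last': "\<forall>u. \<exists>l\<in>insert i (insert j I). s' l = u \<and> x' l + r l = ?e u \<and> x' l - r l \<le> ?e (\<not> u)"
    using xi xj assms(5,6) by (auto simp: ec all_bool_eq)
  show ?thesis unfolding rows_def
    using fin pos assms(5,6) sep' ends' last' K'
    by (intro conjI exI[of _ x'] exI[of _ s']) auto
qed

lemma rows_fill:
  assumes "finite Z" "rows r I K e" "I \<inter> Z = {}" "\<forall>i\<in>Z. r i > 0"
  shows "\<exists>e'. rows r (I \<union> Z) (K + 2 * card Z) e'"
  using assms
proof (induction Z arbitrary: I K e rule: finite_induct)
  case empty then show ?case by auto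
next
  case (insert i Z)
  obtain t where "e t \<le> e (\<not> t)"
    by (cases "e True \<le> e False") (use that[of True] that[of False] in auto)
  then have "rows r (insert i I) (K + 2) (e(t := e t + 2 * r i))"
    using insert by (intro rows_add) auto
  then have "\<exists>e'. rows r (insert i I \<union> Z) (K + 2 + 2 * card Z) e'"
    using insert.hyps insert.prems by (intro insert.IH) auto
  then show ?case using insert.hyps by (simp add: algebra_simps)
qed

text \<open>Always extend the shorter row, row \<open>True\<close> from \<open>P\<close> and row
  \<open>False\<close> from \<open>N\<close>. As the final lengths agree, the shorter row
  (\<open>True\<close> on ties) still has a square to come while any is left.\<close>

lemma rows_balance:
  assumes "finite P" "finite N" "rows r I K e" "I \<inter> P = {}" "I \<inter> N = {}" "P \<inter> N = {}"
    "\<forall>i\<in>P \<union> N. r i > 0" "e True + 2 * sum r P = e False + 2 * sum r N"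
  shows "\<exists>e'. rows r (I \<union> P \<union> N) (K + 2 * (card P + card N)) e' \<and> e' True = e' False"
  using assms
proof (induction "card P + card N" arbitrary: P N I K e)
  case 0
  then have "P = {}" "N = {}" by auto
  then show ?case using "0.prems" by auto
next
  case (Suc k)
  have posP: "\<forall>i\<in>P. r i > 0" and posN: "\<forall>i\<in>N. r i > 0" using Suc.prems by auto
  have neP: "P \<noteq> {}" if "e True \<le> e False"
  proof
    assume "P = {}"
    then have "N \<noteq> {}" using Suc.hyps(2) by auto
    then have "sum r N > 0" using posN Suc.prems by (intro sum_pos) auto
    then show False using that Suc.prems(8) \<open>P = {}\<close> by simp
  qed
  have neN: "N \<noteq> {}" if "e False < e True"
  proof
    assume "N = {}"
    moreover have "sum r P \<ge> 0" using posP by (intro sum_nonneg) (auto intro: less_imp_le)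
    ultimately show False using that Suc.prems(8) by simp
  qed
  show ?case
  proof (cases "e True \<le> e False")
    case True
    then obtain i where i: "i \<in> P" using neP by auto
    have cP: "card P = Suc (card (P - {i}))" and sP: "sum r P = r i + sum r (P - {i})"
      using card.remove[OF Suc.prems(1) i] sum.remove[OF Suc.prems(1) i, of r] by simp_all
    have st: "rows r (insert i I) (K + 2) (e(True := e True + 2 * r i))"
      using Suc.prems i True by (intro rows_add) auto
    have "\<exists>e'. rows r (insert i I \<union> (P - {i}) \<union> N) (K + 2 + 2 * (card (P - {i}) + card N)) e' \<and> e' True = e' False"
    proof (rule Suc.hyps(1)[OF _ _ _ st])
      show "k = card (P - {i}) + card N" using Suc.hyps(2) cP by simp
    qed (use Suc.prems i sP in auto)
    moreover have "insert i I \<union> (P - {i}) \<union> N = I \<union> P \<union> N" using i by auto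
    ultimately show ?thesis using cP by simp
  next
    case False
    then obtain i where i: "i \<in> N" using neN by auto
    have cN: "card N = Suc (card (N - {i}))" and sN: "sum r N = r i + sum r (N - {i})"
      using card.remove[OF Suc.prems(2) i] sum.remove[OF Suc.prems(2) i, of r] by simp_all
    have st: "rows r (insert i I) (K + 2) (e(False := e False + 2 * r i))"
      using Suc.prems i False by (intro rows_add) auto
    have "\<exists>e'. rows r (insert i I \<union> P \<union> (N - {i})) (K + 2 + 2 * (card P + card (N - {i}))) e' \<and> e' True = e' False"
    proof (rule Suc.hyps(1)[OF _ _ _ st])
      show "k = card P + card (N - {i})" using Suc.hyps(2) cN by simp
    qed (use Suc.prems i sN in auto)
    moreover have "insert i I \<union> P \<union> (N - {i}) = I \<union> P \<union> N" using i by auto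
    ultimately show ?thesis using cN by simp
  qed
qed

text \<open>Order of placement: \<open>a\<close>, \<open>b\<close>; then \<open>p\<close>,
  \<open>q\<close>, completing the first crossing; the rest of \<open>P\<close> and
  \<open>N\<close>, levelling the rows; \<open>c\<close>, \<open>d\<close> at the second crossing;
  everything else. The six named squares account for \<open>1 + 5 + 5 = 2 * 6 - 1\<close> contacts,
  every other one for 2.\<close>

lemma ex_rows_of_balanced:
  assumes "finite V" "\<forall>i\<in>V. r i > 0" "P \<subseteq> V" "N \<subseteq> V" "P \<inter> N = {}" "P \<noteq> {}" "N \<noteq> {}"
    "sum r P = sum r N" "card (V - P - N) \<ge> 4"
  shows "\<exists>e. rows r V (2 * card V - 1) e"
proof -
  obtain S where S: "S \<subseteq> V - P - N" "card S = 4"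
    using obtain_subset_with_card_n[OF assms(9)] by metis
  then obtain a b c d where abcd: "S = {a, b, c, d}" "distinct [a, b, c, d]"
    by (auto simp: card_Suc_eq numeral_eq_Suc)
  obtain p q where p: "p \<in> P" and q: "q \<in> N" using assms by auto
  have fin: "finite P" "finite N" using assms finite_subset by blast+
  define P' N' where "P' = P - {p}" and "N' = N - {q}"
  have cP: "card P = Suc (card P')" and sP: "sum r P = r p + sum r P'"
    using card.remove[OF fin(1) p] sum.remove[OF fin(1) p, of r] by (simp_all add: P'_def)
  have cN: "card N = Suc (card N')" and sN: "sum r N = r q + sum r N'"
    using card.remove[OF fin(2) q] sum.remove[OF fin(2) q, of r] by (simp_all add: N'_def)
  have abcdV: "a \<in> V - P - N" "b \<in> V - P - N" "c \<in> V - P - N" "d \<in> V - P - N" using S abcd by auto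
  have pq: "p \<noteq> q" "p \<in> V" "q \<in> V" "p \<notin> {a, b, c, d}" "q \<notin> {a, b, c, d}" "p \<notin> N" "q \<notin> P"
    using p q assms abcdV by auto
  have 1: "rows r {a, b} 1 (\<lambda>_. 0)" using abcd abcdV assms by (intro rows_init) auto
  have 2: "rows r (insert p (insert q {a, b})) (1 + 5) (\<lambda>u. if u then 0 + 2 * r p else 0 + 2 * r q)"
    using pq assms(2) by (intro rows_add_pair[OF 1]) auto
  have "\<exists>e'. rows r (insert p (insert q {a, b}) \<union> P' \<union> N') (1 + 5 + 2 * (card P' + card N')) e' \<and> e' True = e' False"
    using fin abcdV pq assms sP sN by (intro rows_balance[OF _ _ 2]) (auto simp: P'_def N'_def)
  moreover have "insert p (insert q {a, b}) \<union> P' \<union> N' = {a, b} \<union> P \<union> N"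
    using p q by (auto simp: P'_def N'_def)
  ultimately obtain e where e: "rows r ({a, b} \<union> P \<union> N) (1 + 5 + 2 * (card P' + card N')) e" "e True = e False"
    by auto
  have 3: "rows r (insert c (insert d ({a, b} \<union> P \<union> N))) (1 + 5 + 2 * (card P' + card N') + 5)
     (\<lambda>u. if u then e True + 2 * r c else e False + 2 * r d)"
    using abcd abcdV assms(2) e(2) by (intro rows_add_pair[OF e(1)]) auto
  define J where "J = insert c (insert d ({a, b} \<union> P \<union> N))"
  have "\<exists>e'. rows r (J \<union> (V - J)) (1 + 5 + 2 * (card P' + card N') + 5 + 2 * card (V - J)) e'"
    using 3 assms by (intro rows_fill[of _ _ J]) (auto simp: J_def)
  moreover have JV: "J \<subseteq> V" using abcdV assms by (auto simp: J_def)
  moreover have "J \<union> (V - J) = V" using JV by auto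
  moreover have "card J = 4 + (card P + card N)"
  proof -
    have "J = S \<union> (P \<union> N)" by (auto simp: J_def abcd)
    moreover have "S \<inter> (P \<union> N) = {}" using S by auto
    moreover have "finite S" using abcd by auto
    ultimately show ?thesis using S fin assms(5) by (simp add: card_Un_disjoint)
  qed
  moreover have "card V = card J + card (V - J)"
    using JV assms(1) by (metis card_Diff_subset card_mono finite_subset le_add_diff_inverse)
  ultimately have "\<exists>e'. rows r V (1 + 5 + 2 * (card P' + card N') + 5 + 2 * card (V - J)) e'"
    "1 + 5 + 2 * (card P' + card N') + 5 + 2 * card (V - J) = 2 * card V - 1"
    using cP cN by auto
  then show ?thesis by simp
qed

section \<open>From rows to homothetic packings\<close>

lemma hcopy_eq:
  assumes "r > 0"
  shows "hcopy r (a, b) = {a - r..a + r} \<times> {b - r..b + r}"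
proof -
  have "(x, y) \<in> hcopy r (a, b)" if "x \<in> {a - r..a + r}" "y \<in> {b - r..b + r}" for x y
  proof -
    have "(x, y) = r *\<^sub>R ((x - a) / r, (y - b) / r) + (a, b)" using assms by simp
    moreover have "((x - a) / r, (y - b) / r) \<in> std_square"
      using that assms by (auto simp: std_square_def field_simps)
    ultimately show ?thesis unfolding hcopy_def by blast
  qed
  moreover have "x \<in> {a - r..a + r} \<and> y \<in> {b - r..b + r}" if xy: "(x, y) \<in> hcopy r (a, b)" for x y
  proof -
    obtain z where z: "z \<in> std_square" "(x, y) = r *\<^sub>R z + (a, b)"
      using xy by (auto simp: hcopy_def)
    define u v where "u = fst z" and "v = snd z"
    have uv: "x = r * u + a" "y = r * v + b" "-1 \<le> u" "u \<le> 1" "-1 \<le> v" "v \<le> 1"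
      using z by (auto simp: std_square_def u_def v_def)
    have "r * (-1) \<le> r * u" "r * u \<le> r * 1" "r * (-1) \<le> r * v" "r * v \<le> r * 1"
      using uv assms by (intro mult_left_mono; simp)+
    then show ?thesis using uv by auto
  qed
  ultimately have "(x, y) \<in> hcopy r (a, b) \<longleftrightarrow> (x, y) \<in> {a - r..a + r} \<times> {b - r..b + r}" for x y
    unfolding mem_Times_iff by (metis fst_conv snd_conv)
  then show ?thesis by (intro set_eqI) (metis surj_pair)
qed

lemma hcopy_meet_iff:
  assumes "r > 0" "s > 0"
  shows "hcopy r p \<inter> hcopy s q \<noteq> {} \<longleftrightarrow> \<bar>fst p - fst q\<bar> \<le> r + s \<and> \<bar>snd p - snd q\<bar> \<le> r + s"
proof -
  have "{a - r..a + r} \<inter> {c - s..c + s} \<noteq> {} \<longleftrightarrow> \<bar>a - c\<bar> \<le> r + s" for a c :: real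
    using assms by (simp add: Int_atLeastAtMost) linarith
  then show ?thesis using assms
    by (cases p; cases q) (simp add: hcopy_eq Times_Int_Times Times_empty)
qed

lemma hcopy_interior_disjoint_iff:
  assumes "r > 0" "s > 0"
  shows "interior (hcopy r p) \<inter> interior (hcopy s q) = {} \<longleftrightarrow>
    r + s \<le> \<bar>fst p - fst q\<bar> \<or> r + s \<le> \<bar>snd p - snd q\<bar>"
proof -
  have "{a - r<..<a + r} \<inter> {c - s<..<c + s} = {} \<longleftrightarrow> r + s \<le> \<bar>a - c\<bar>" for a c :: real
  proof -
    have "{a - r<..<a + r} \<inter> {c - s<..<c + s} = {max (a - r) (c - s)<..<min (a + r) (c + s)}" by auto
    also have "\<dots> = {} \<longleftrightarrow> min (a + r) (c + s) \<le> max (a - r) (c - s)" by simp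
    finally show ?thesis using assms by (auto simp: min_def max_def)
  qed
  then show ?thesis using assms
    by (cases p; cases q)
       (simp add: hcopy_eq interior_Times Times_Int_Times Times_empty interior_atLeastAtMost_real)
qed

lemma ex_packing_of_balanced:
  assumes pos: "\<forall>i\<in>{1..n}. r i > 0" and sg: "\<forall>i\<in>{1..n}. \<sigma> i \<in> {-1, 0, 1 :: int}"
    and z: "card {i \<in> {1..n}. \<sigma> i = 0} \<ge> 4"
    and s0: "(\<Sum>i = 1..n. real_of_int (\<sigma> i) * r i) = 0"
    and nz: "k \<in> {1..n}" "\<sigma> k \<noteq> 0"
  shows "\<exists>p. homothetic_packing n r p \<and> card (contacts n r p) \<ge> 2 * n - 1"
proof -
  define P N where "P = {i\<in>{1..n}. \<sigma> i = 1}" and "N = {i\<in>{1..n}. \<sigma> i = -1}"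
  have "(\<Sum>i = 1..n. real_of_int (\<sigma> i) * r i) = (\<Sum>i = 1..n. (if \<sigma> i = 1 then r i else 0) - (if \<sigma> i = -1 then r i else 0))"
    using sg by (intro sum.cong) auto
  also have "\<dots> = sum r P - sum r N"
    unfolding P_def N_def by (simp only: sum_subtractf sum.inter_filter[OF finite_atLeastAtMost])
  finally have PN: "sum r P = sum r N" using s0 by simp
  have posP: "sum r P > 0" if "P \<noteq> {}" using pos that by (intro sum_pos) (auto simp: P_def)
  have posN: "sum r N > 0" if "N \<noteq> {}" using pos that by (intro sum_pos) (auto simp: N_def)
  have "P \<noteq> {} \<or> N \<noteq> {}" using nz sg by (auto simp: P_def N_def)
  then have ne: "P \<noteq> {}" "N \<noteq> {}" using posP posN PN by fastforce+
  have "{i \<in> {1..n}. \<sigma> i = 0} = {1..n} - P - N" using sg by (auto simp: P_def N_def)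
  then have "\<exists>e. rows r {1..n} (2 * card {1..n} - 1) e"
    using z PN ne pos by (intro ex_rows_of_balanced[of _ _ P N]) (auto simp: P_def N_def)
  then obtain e where e: "rows r {1..n} (2 * card {1..n} - 1) e" ..
  obtain x s where
    sep: "\<forall>i\<in>{1..n}. \<forall>j\<in>{1..n}. i \<noteq> j \<and> s i = s j \<longrightarrow> r i + r j \<le> \<bar>x i - x j\<bar>"
    and "\<forall>i\<in>{1..n}. x i + r i \<le> e (s i)"
    and K: "2 * card {1..n} - 1 \<le> card (edge_set (\<lambda>i j. \<bar>x i - x j\<bar> \<le> r i + r j) {1..n})"
    using e unfolding rows_def by (elim conjE exE) (rule that; assumption)
  \<comment> \<open>These heights put a side of every square on \<open>y = 0\<close>: squares in
    different rows have vertical distance exactly \<open>r i + r j\<close>, and within a row the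
    vertical distance never prevents a contact.\<close>
  define p where "p = (\<lambda>i. (x i, if s i then r i else - r i))"
  have "homothetic_packing n r p"
    unfolding homothetic_packing_def
  proof (intro conjI ballI impI)
    fix i j assume ij: "i \<in> {1..n}" "j \<in> {1..n}" "i \<noteq> j"
    show "interior (hcopy (r i) (p i)) \<inter> interior (hcopy (r j) (p j)) = {}"
      using sep ij pos by (subst hcopy_interior_disjoint_iff) (auto simp: p_def)
  qed (use pos in auto)
  moreover have "edge_set (\<lambda>i j. \<bar>x i - x j\<bar> \<le> r i + r j) {1..n} \<subseteq> contacts n r p"
    unfolding contacts_def edge_set_def[symmetric]
  proof (rule edge_set_mono)
    fix i j assume ij: "i \<in> {1..n}" "j \<in> {1..n}" "\<bar>x i - x j\<bar> \<le> r i + r j"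
    have "r i > 0" "r j > 0" using ij pos by auto
    then show "hcopy (r i) (p i) \<inter> hcopy (r j) (p j) \<noteq> {}"
      using ij by (subst hcopy_meet_iff) (auto simp: p_def)
  qed simp
  moreover have "finite (contacts n r p)"
    unfolding contacts_def edge_set_def[symmetric] by (intro finite_edge_set) auto
  ultimately have "card (edge_set (\<lambda>i j. \<bar>x i - x j\<bar> \<le> r i + r j) {1..n}) \<le> card (contacts n r p)"
    by (intro card_mono)
  then have "2 * n - 1 \<le> card (contacts n r p)" using K by simp
  then show ?thesis using \<open>homothetic_packing n r p\<close> by blast
qed

section \<open>The equivalence\<close>

lemma card_contacts_le:
  assumes pack: "homothetic_packing n r p" and unb: "unbalanced {1..n} r" and "n \<ge> 1"
  shows "card (contacts n r p) \<le> 2 * n - 2"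
proof -
  define X Y where "X = (\<lambda>i. fst (p i))" and "Y = (\<lambda>i. snd (p i))"
  have pos: "r i > 0" if "i \<in> {1..n}" for i
    using pack that by (simp add: homothetic_packing_def)
  have sep: "r i + r j \<le> \<bar>X i - X j\<bar> \<or> r i + r j \<le> \<bar>Y i - Y j\<bar>"
    if "i \<in> {1..n}" "j \<in> {1..n}" "i \<noteq> j" for i j
    using pack that hcopy_interior_disjoint_iff[OF pos[OF that(1)] pos[OF that(2)], of "p i" "p j"]
    by (simp add: homothetic_packing_def X_def Y_def)
  interpret square_packing "{1..n}" r X Y
    by unfold_locales (use pos sep in auto)
  let ?Ex = "edge_set (adj r X Y) {1..n}" and ?Ey = "edge_set (adj r Y (\<lambda>i. - X i)) {1..n}"
  have "contacts n r p \<subseteq> ?Ex \<union> ?Ey"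
  proof
    fix e assume "e \<in> contacts n r p"
    then obtain i j where e: "e = {i, j}" and ij: "i \<in> {1..n}" "j \<in> {1..n}" "i \<noteq> j"
      and meet: "hcopy (r i) (p i) \<inter> hcopy (r j) (p j) \<noteq> {}"
      unfolding contacts_def by blast
    have "\<bar>X i - X j\<bar> \<le> r i + r j" "\<bar>Y i - Y j\<bar> \<le> r i + r j"
      using meet hcopy_meet_iff[OF pos[OF ij(1)] pos[OF ij(2)]] by (auto simp: X_def Y_def)
    \<comment> \<open>\<open>sep\<close> forces equality in one of the two bounds. The half-open
      range in \<open>east\<close> leaves out the south-east corners, which the rotated graph
      catches.\<close>
    then have "adj r X Y i j \<or> adj r Y (\<lambda>i. - X i) i j"
      using sep[OF ij] pos[OF ij(1)] pos[OF ij(2)] unfolding adj_def east_def by linarith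
    then show "e \<in> ?Ex \<union> ?Ey" using e ij unfolding edge_set_def by blast
  qed
  then have "card (contacts n r p) \<le> card (?Ex \<union> ?Ey)"
    by (intro card_mono) (simp_all add: finite_edge_set)
  also have "\<dots> \<le> card ?Ex + card ?Ey" by (rule card_Un_le)
  also have "\<dots> \<le> 2 * n - 2" using card_adj_le[OF unb] \<open>n \<ge> 1\<close> by simp
  finally show ?thesis .
qed

theorem theorem1:
  fixes n :: nat and r :: "nat \<Rightarrow> real"
  assumes "n \<ge> 1"
    and "\<forall>i\<in>{1..n}. r i > 0"
  shows "(\<forall>p. homothetic_packing n r p \<longrightarrow> card (contacts n r p) \<le> 2 * n - 2)
     \<longleftrightarrow>
     (\<forall>\<sigma> :: nat \<Rightarrow> int.
        (\<forall>i\<in>{1..n}. \<sigma> i \<in> {-1, 0, 1}) \<and>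
        card {i \<in> {1..n}. \<sigma> i = 0} \<ge> 4 \<and>
        (\<Sum>i = 1..n. real_of_int (\<sigma> i) * r i) = 0
        \<longrightarrow> (\<forall>i\<in>{1..n}. \<sigma> i = 0))"
proof -
  have unb: "(\<forall>\<sigma> :: nat \<Rightarrow> int.
        (\<forall>i\<in>{1..n}. \<sigma> i \<in> {-1, 0, 1}) \<and>
        card {i \<in> {1..n}. \<sigma> i = 0} \<ge> 4 \<and>
        (\<Sum>i = 1..n. real_of_int (\<sigma> i) * r i) = 0
        \<longrightarrow> (\<forall>i\<in>{1..n}. \<sigma> i = 0)) \<longleftrightarrow> unbalanced {1..n} r"
    by (simp only: unbalanced_def)
  have "unbalanced {1..n} r"
    if few: "\<forall>p. homothetic_packing n r p \<longrightarrow> card (contacts n r p) \<le> 2 * n - 2"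
    unfolding unbalanced_def
  proof (intro allI impI, elim conjE, rule ccontr)
    fix \<sigma> :: "nat \<Rightarrow> int"
    assume "\<forall>i\<in>{1..n}. \<sigma> i \<in> {-1, 0, 1}" "4 \<le> card {i \<in> {1..n}. \<sigma> i = 0}"
      "(\<Sum>i = 1..n. real_of_int (\<sigma> i) * r i) = 0" "\<not> (\<forall>i\<in>{1..n}. \<sigma> i = 0)"
    then obtain p where "homothetic_packing n r p" "2 * n - 1 \<le> card (contacts n r p)"
      using ex_packing_of_balanced[OF assms(2)] by blast
    \<comment> \<open>Subtraction is truncated: at \<open>n = 0\<close> both sides would be
      \<open>0\<close>.\<close>
    moreover have "2 * n - 2 < 2 * n - 1" using assms(1) by linarith
    ultimately show False using few by (meson leD le_less_trans)
  qed
  moreover have "card (contacts n r p) \<le> 2 * n - 2"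
    if "unbalanced {1..n} r" "homothetic_packing n r p" for p
    using card_contacts_le[OF that(2,1) assms(1)] .
  ultimately show ?thesis unfolding unb by blast
qed

end
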